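(* Let $(X,\|\cdot\|)$ and $(Y,\|\cdot\|)$ be Banach spaces. Consider a point $\bar x\in X$ along with a continuous mapping $f:X\to Y$ and a set-valued mapping $F:X\rightrightarrows Y$ with closed graph such that $f(\bar x)+F(\bar x)\ni0$. Suppose that there is a set-valued mapping $\mathcal{H}:X\rightrightarrows\mathcal{L}(X,Y)$ which is upper semicontinuous at $\bar x\in\mathrm{int}\,\mathrm{dom}\,\mathcal{H}$ with $\chi(\mathcal{H}(\bar x))<\infty$, and such that, for each $A\in\mathcal{H}(\bar x)$, the mapping $G_A:X\rightrightarrows Y$ defined by $$G_A(x):=f(\bar x)+A(x-\bar x)+F(x),\quad x\in X,$$ is (metrically) regular around $(\bar x,0)$, and $$\lim_{x\to\bar x,\ x\ne\bar x}\frac{\sup_{A\in\mathcal{H}(x)}\|f(x)-f(\bar x)-A(x-\bar x)\|}{\|x-\bar x\|}=0.$$ Let $(R_k)$ be a sequence of set-valued mappings $R_k:X\times X\rightrightarrows Y$, $k\in\mathbb{N}_0$, with closed graphs such that $(\bar x,\bar x)\in\mathrm{int}\big(\bigcap_{k\in\mathbb{N}_0}\mathrm{dom}\,R_k\big)$ and $0\in R_k(\bar x,\bar x)$ for each $k\in\mathbb{N}_0$, and assume that there are positive constants $a$, $\gamma$, and $\ell$ satisfying $$\chi(\mathcal{H}(\bar x))+\ell+\gamma<\inf_{A\in\mathcal{H}(\bar x)}\mathrm{sur}\,G_A(\bar x,0)$$ such that $$\limsup_{x\to\bar x,\ x\neq\bar x}\frac{\sup_{k\in\mathbb{N}_0}\mathrm{dist}\big(0,R_k(x,\bar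 x)\big)}{\|x-\bar x\|}<\gamma,$$ and that, for all $x,u,u'\in\mathbb{B}(\bar x,a)$ and all $k\in\mathbb{N}_0$, we have $$R_k(x,u)\cap\mathbb{B}(0,a)\subset R_k(x,u')+\ell\|u-u'\|\,\mathbb{B}_Y.$$ Then there exist $t\in(0,1)$ and $r>0$ such that, for any starting point $x_0\in\mathbb{B}(\bar x,r)$, there exists a sequence $(x_k)$ in $\mathbb{B}(\bar x,r)$ generated by the iteration "given $k\in\mathbb{N}_0$ and $x_k\in X$, choose any $A_k\in\mathcal{H}(x_k)$ and then find $x_{k+1}\in X$ satisfying $\big(f(x_k)+A_k(x_{k+1}-x_k)+F(x_{k+1})\big)\cap R_k(x_k,x_{k+1})\neq\emptyset$" (with $A_k\in\mathcal{H}(x_k)$ chosen arbitrarily at each step) such that $$\|x_{k+1}-\bar x\|\le t\,\|x_k-\bar x\|\quad\text{for each } k\in\mathbb{N}_0,$$ that is, $(x_k)$ converges q-linearly to $\bar x$.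
   Context: $\mathbb{N}_0=\{0,1,2,\dots\}$. $\mathbb{B}(u,r)$ and $\mathbb{B}[u,r]$ are the open and closed balls; $\mathbb{B}_Z$ is the closed unit ball of a normed space $Z$. $\mathcal{L}(X,Y)$ is the space of bounded linear operators from $X$ into $Y$ with the operator norm. For a set-valued mapping $F$ (values may be empty): $\mathrm{dom}\,F=\{x:F(x)\ne\emptyset\}$, $\mathrm{gph}\,F=\{(x,y):y\in F(x)\}$, $F^{-1}(y)=\{x:y\in F(x)\}$, $F(C)=\bigcup_{x\in C}F(x)$. $\mathrm{dist}(u,C)$ is the distance from $u$ to the set $C$ ($\inf\emptyset=\infty$). $\mathcal{H}$ is upper semicontinuous at $\bar x$ if for every open set $O\supset\mathcal{H}(\bar x)$ there is a neighborhood $U$ of $\bar x$ with $\mathcal{H}(x)\subset O$ for all $x\in U$. The measure of noncompactness of $\mathcal{A}\subset\mathcal{L}(X,Y)$ is $\chi(\mathcal{A})=\inf\{r>0:\ \mathcal{A}\subset\mathcal{F}+r\,\mathbb{B}_{\mathcal{L}(X,Y)}\text{ for some finite }\mathcal{F}\subset\mathcal{A}\}$. A mapping $G:X\rightrightarrows Y$ is (metrically) regular around $(\bar x,\bar y)$ when $\bar y\in G(\bar x)$ and there are $\kappa>0$ and a neighborhood $U\times V$ of $(\bar x,\bar y)$ such that $\mathrm{dist}(x,G^{-1}(y))\le\kappa\,\mathrm{dist}(y,G(x))$ for every $(x,y)\in U\times V$. The modulus of surjection $\mathrm{sur}\,G(\bar x,\bar y)$ is the supremum of all $c>0$ for which there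 are $\varepsilon>0$ and a neighborhood $U\times V$ of $(\bar x,\bar y)$ such that $\mathbb{B}[y,ct]\subset G(\mathbb{B}[x,t])$ whenever $(x,y)\in U\times V$, $y\in G(x)$ and $t\in(0,\varepsilon)$ ($\sup\emptyset=0$). *)

theory Defs
  imports "HOL-Analysis.Analysis" "HOL-Library.Set_Algebras"
begin

text \<open>A set-valued mapping from \<open>X\<close> to \<open>Y\<close> is a function of type \<open>'x \<Rightarrow> 'y set\<close>, with empty values
  allowed. Extended quantities (distances to sets, moduli, suprema) live in \<^typ>\<open>ennreal\<close>, where
  \<open>Inf {} = \<infinity>\<close> and \<open>Sup {} = 0\<close>. The sum \<open>v +o S\<close> is the translate of the set \<open>S\<close> by \<open>v\<close>,
  and \<open>S + T\<close> is the Minkowski sum.\<close>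

definition sv_dom :: "('x \<Rightarrow> 'y set) \<Rightarrow> 'x set" where
  "sv_dom G = {x. G x \<noteq> {}}"

definition sv_graph :: "('x \<Rightarrow> 'y set) \<Rightarrow> ('x \<times> 'y) set" where
  "sv_graph G = {(x, y). y \<in> G x}"

definition sv_inverse :: "('x \<Rightarrow> 'y set) \<Rightarrow> 'y \<Rightarrow> 'x set" where
  "sv_inverse G y = {x. y \<in> G x}"

definition sv_image :: "('x \<Rightarrow> 'y set) \<Rightarrow> 'x set \<Rightarrow> 'y set" where
  "sv_image G C = (\<Union>x\<in>C. G x)"

text \<open>Unlike \<^const>\<open>infdist\<close>, the distance to the empty set is \<open>\<infinity>\<close>.\<close>

definition set_dist :: "'y::metric_space \<Rightarrow> 'y set \<Rightarrow> ennreal" where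
  "set_dist u C = (INF c\<in>C. ennreal (dist u c))"

definition upper_semicontinuous_at ::
  "('x::topological_space \<Rightarrow> 'y::topological_space set) \<Rightarrow> 'x \<Rightarrow> bool" where
  "upper_semicontinuous_at H x \<longleftrightarrow>
     (\<forall>W. open W \<and> H x \<subseteq> W \<longrightarrow> (\<exists>U. open U \<and> x \<in> U \<and> (\<forall>u\<in>U. H u \<subseteq> W)))"

definition noncompactness_measure :: "'z::real_normed_vector set \<Rightarrow> ennreal" where
  "noncompactness_measure S =
     Inf {ennreal r |r. r > 0 \<and>
            (\<exists>E. finite E \<and> E \<subseteq> S \<and> S \<subseteq> E + (*\<^sub>R) r ` cball 0 1)}"

definition metrically_regular_around ::
  "('x::metric_space \<Rightarrow> 'y::metric_space set) \<Rightarrow> 'x \<Rightarrow> 'y \<Rightarrow> bool" where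
  "metrically_regular_around G x0 y0 \<longleftrightarrow>
     y0 \<in> G x0 \<and>
     (\<exists>\<kappa>::real. \<kappa> > 0 \<and>
       (\<exists>U V. open U \<and> x0 \<in> U \<and> open V \<and> y0 \<in> V \<and>
         (\<forall>x\<in>U. \<forall>y\<in>V. set_dist x (sv_inverse G y) \<le> ennreal \<kappa> * set_dist y (G x))))"

definition surjection_modulus ::
  "('x::metric_space \<Rightarrow> 'y::metric_space set) \<Rightarrow> 'x \<Rightarrow> 'y \<Rightarrow> ennreal" where
  "surjection_modulus G x0 y0 =
     Sup {ennreal c |c. c > 0 \<and>
       (\<exists>\<epsilon>>0. \<exists>U V. open U \<and> x0 \<in> U \<and> open V \<and> y0 \<in> V \<and>
         (\<forall>x\<in>U. \<forall>y\<in>V. \<forall>t. y \<in> G x \<and> 0 < t \<and> t < \<epsilon> \<longrightarrow>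
            cball y (c * t) \<subseteq> sv_image G (cball x t)))}"

definition partial_linearization ::
  "('x::real_normed_vector \<Rightarrow> 'y::real_normed_vector) \<Rightarrow> ('x \<Rightarrow> 'y set) \<Rightarrow> 'x \<Rightarrow>
   ('x \<Rightarrow>\<^sub>L 'y) \<Rightarrow> 'x \<Rightarrow> 'y set" where
  "partial_linearization f F z A x = (f z + blinfun_apply A (x - z)) +o F x"

text \<open>The arbitrary choice of \<open>A\<^sub>k \<in> H(x\<^sub>k)\<close> at each step is modelled by a rule \<open>\<sigma>\<close> that sees the
  whole history \<open>[x\<^sub>0, \<dots>, x\<^sub>k]\<close>. Only the values of \<open>\<sigma>\<close> at histories ending in the domain of \<open>H\<close>
  are constrained, so that choice rules exist for every \<open>H\<close>. That an element of \<open>H(x\<^sub>k)\<close> is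
  available along the iteration is part of \<open>newton_iterates\<close> instead.\<close>

definition choice_rule :: "('x \<Rightarrow> 'z set) \<Rightarrow> ('x list \<Rightarrow> 'z) \<Rightarrow> bool" where
  "choice_rule H \<sigma> \<longleftrightarrow> (\<forall>h. h \<noteq> [] \<and> H (last h) \<noteq> {} \<longrightarrow> \<sigma> h \<in> H (last h))"

definition newton_iterates ::
  "('x::real_normed_vector \<Rightarrow> 'y::real_normed_vector) \<Rightarrow> ('x \<Rightarrow> 'y set) \<Rightarrow>
   ('x \<Rightarrow> ('x \<Rightarrow>\<^sub>L 'y) set) \<Rightarrow> (nat \<Rightarrow> 'x \<times> 'x \<Rightarrow> 'y set) \<Rightarrow>
   ('x list \<Rightarrow> ('x \<Rightarrow>\<^sub>L 'y)) \<Rightarrow> (nat \<Rightarrow> 'x) \<Rightarrow> bool" where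
  "newton_iterates f F H R \<sigma> x \<longleftrightarrow>
     (\<forall>k. \<exists>A. A = \<sigma> (map x [0..<Suc k]) \<and> A \<in> H (x k) \<and>
        partial_linearization f F (x k) A (x (Suc k)) \<inter> R k (x k, x (Suc k)) \<noteq> {})"

end

theory Submission
  imports Defs
begin

text \<open>One Newton step is a Lyusternik--Graves argument carried out at \<open>xbar\<close>. Choose reals \<open>m\<close> and \<open>c\<close>
  with \<open>\<chi>(H xbar) < m\<close> and \<open>m + l + \<gamma> < c\<close>, where \<open>c\<close> is smaller than every modulus of surjection of
  the linearizations \<open>G C = f xbar + C (\<cdot> - xbar) + F\<close>, \<open>C \<in> H xbar\<close>. The measure of noncompactness
  provides a finite set \<open>E \<subseteq> H xbar\<close> whose open \<open>m\<close>-neighbourhood contains \<open>H xbar\<close>, hence, by upper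
  semicontinuity, also \<open>H x\<close> for \<open>x\<close> near \<open>xbar\<close> (\<open>finite_net_near\<close>). Finiteness of \<open>E\<close> makes the
  neighbourhoods in which the \<open>G C\<close>, \<open>C \<in> E\<close>, are open at rate \<open>c\<close> uniform (\<open>linearly_open_uniform\<close>).

  Let \<open>x\<close> be near \<open>xbar\<close>, let \<open>A \<in> H x\<close>, and take \<open>C \<in> E\<close> with \<open>\<parallel>A - C\<parallel> \<le> m\<close>. With the linearization
  error \<open>e = f x - f xbar - A (x - xbar)\<close>,
  \<open>f x + A (u - x) + F u = G C u + e + (A - C) (u - xbar)\<close>,
  so the next iterate is a point \<open>u\<close> at which the map \<open>G C + (A - C) (\<cdot> - xbar) - R k (x, \<cdot>)\<close> has
  \<open>-e\<close> among its values. This map is a perturbation of \<open>G C\<close> by Lipschitz terms of total constant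
  \<open>m + l < c\<close>, so it is open at rate \<open>c - l - m\<close>. At \<open>u = xbar\<close> one of its values is \<open>- y0\<close>, where
  \<open>y0 \<in> R k (x, xbar)\<close>. The bounds on the residuals \<open>R k\<close> and on \<open>e\<close> give
  \<open>\<parallel>y0\<parallel> + \<parallel>e\<parallel> \<le> \<gamma> \<parallel>x - xbar\<parallel>\<close>, hence a solution \<open>u\<close> with
  \<open>\<parallel>u - xbar\<parallel> \<le> t \<parallel>x - xbar\<parallel>\<close> for \<open>t = \<gamma> / (c - l - m) < 1\<close>. The stability of openness is
  \<open>solve_perturbed_inclusion\<close>, and its application is \<open>newton_step\<close>. Neither \<open>t\<close> nor the
  neighbourhood depends on \<open>A\<close> or \<open>k\<close>, so the steps can be chained for every choice rule
  (\<open>iterates_of_steps\<close>).\<close>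

section \<open>Linear openness and its stability under Lipschitz perturbations\<close>

text \<open>A single number \<open>\<epsilon>\<close> bounds both neighbourhoods and the step size, so that finitely many such
  conditions can be combined by taking a minimum.\<close>

definition linearly_open ::
  "('x::metric_space \<Rightarrow> 'y::metric_space set) \<Rightarrow> 'x \<Rightarrow> 'y \<Rightarrow> real \<Rightarrow> real \<Rightarrow> bool" where
  "linearly_open G x0 z0 c \<epsilon> \<longleftrightarrow>
     (\<forall>x\<in>ball x0 \<epsilon>. \<forall>z\<in>ball z0 \<epsilon>. \<forall>t. z \<in> G x \<and> 0 < t \<and> t < \<epsilon> \<longrightarrow>
        cball z (c * t) \<subseteq> sv_image G (cball x t))"

lemma linearly_open_mono:
  assumes "linearly_open G x0 z0 c \<epsilon>" "\<epsilon>' \<le> \<epsilon>"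
  shows "linearly_open G x0 z0 c \<epsilon>'"
  unfolding linearly_open_def
proof (intro ballI allI impI)
  fix x z t
  assume "x \<in> ball x0 \<epsilon>'" "z \<in> ball z0 \<epsilon>'" and t: "z \<in> G x \<and> 0 < t \<and> t < \<epsilon>'"
  then have "x \<in> ball x0 \<epsilon>" "z \<in> ball z0 \<epsilon>" "z \<in> G x \<and> 0 < t \<and> t < \<epsilon>"
    using assms(2) by auto
  then show "cball z (c * t) \<subseteq> sv_image G (cball x t)"
    using assms(1)[unfolded linearly_open_def] by blast
qed

text \<open>The form used in iterations: a prescribed value \<open>w\<close> is reached by a step proportional to its
  distance from a known value, and a zero distance is allowed.\<close>

lemma linearly_openD:
  assumes "linearly_open G x0 z0 c \<epsilon>" "c > 0"
    and "dist x0 x < \<epsilon>" "dist z0 z < \<epsilon>" "z \<in> G x" "dist z w / c < \<epsilon>"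
  obtains x' where "w \<in> G x'" "dist x x' \<le> dist z w / c"
proof (cases "z = w")
  case True
  with assms that[of x] show ?thesis by simp
next
  case False
  let ?t = "dist z w / c"
  have "?t > 0" using False assms(2) by simp
  then have "cball z (c * ?t) \<subseteq> sv_image G (cball x ?t)"
    using assms(1)[unfolded linearly_open_def, rule_format, of x z ?t] assms(3-6) by simp
  moreover have "w \<in> cball z (c * ?t)" using assms(2) by simp
  ultimately show ?thesis using that unfolding sv_image_def by auto
qed

lemma linearly_open_below_surjection_modulus:
  assumes "ennreal c < surjection_modulus G x0 z0" "c \<ge> 0"
  shows "\<exists>\<epsilon>>0. linearly_open G x0 z0 c \<epsilon>"
proof -
  obtain c' \<epsilon> U V where c': "ennreal c < ennreal c'" "c' > 0" "\<epsilon> > 0"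
    and UV: "open U" "x0 \<in> U" "open V" "z0 \<in> V"
    and sub: "\<forall>x\<in>U. \<forall>y\<in>V. \<forall>t. y \<in> G x \<and> 0 < t \<and> t < \<epsilon> \<longrightarrow>
            cball y (c' * t) \<subseteq> sv_image G (cball x t)"
    using assms(1) unfolding surjection_modulus_def less_Sup_iff by blast
  obtain d1 where d1: "d1 > 0" "ball x0 d1 \<subseteq> U" using UV open_contains_ball by blast
  obtain d2 where d2: "d2 > 0" "ball z0 d2 \<subseteq> V" using UV open_contains_ball by blast
  have cc: "c \<le> c'" using c' assms(2) by (simp add: ennreal_less_iff)
  have "linearly_open G x0 z0 c (min \<epsilon> (min d1 d2))"
    unfolding linearly_open_def
  proof (intro ballI allI impI)
    fix x z t
    assume x: "x \<in> ball x0 (min \<epsilon> (min d1 d2))" and z: "z \<in> ball z0 (min \<epsilon> (min d1 d2))"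
      and t: "z \<in> G x \<and> 0 < t \<and> t < min \<epsilon> (min d1 d2)"
    have "x \<in> U" "z \<in> V" using x z d1 d2 by auto
    then have "cball z (c' * t) \<subseteq> sv_image G (cball x t)" using sub t by auto
    moreover have "cball z (c * t) \<subseteq> cball z (c' * t)"
      using cc t by (intro subset_cball mult_right_mono) auto
    ultimately show "cball z (c * t) \<subseteq> sv_image G (cball x t)" by blast
  qed
  then show ?thesis using c' d1 d2 by (intro exI[of _ "min \<epsilon> (min d1 d2)"]) auto
qed

lemma convergent_of_geometric_steps:
  fixes v :: "nat \<Rightarrow> 'a::banach"
  assumes "\<And>n. norm (v (Suc n) - v n) \<le> C * q ^ n" "0 \<le> q" "q < 1"
  shows "convergent v"
proof -
  have "summable (\<lambda>n. C * q ^ n)" using assms by (intro summable_mult summable_geometric) auto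
  then have "summable (\<lambda>n. v (Suc n) - v n)"
    by (rule summable_comparison_test'[where N=0]) (use assms in auto)
  then have "convergent (\<lambda>n. \<Sum>k<n. v (Suc k) - v k)" by (simp add: summable_iff_convergent)
  then have "convergent (\<lambda>n. v n - v 0)" by (simp add: sum_lessThan_telescope)
  then have "convergent (\<lambda>n. (v n - v 0) + v 0)" using convergent_add convergent_const by blast
  then show ?thesis by simp
qed

lemma closed_sv_graph_limit:
  fixes u :: "nat \<Rightarrow> 'x::metric_space" and w :: "nat \<Rightarrow> 'y::metric_space"
  assumes "closed (sv_graph Q)" "\<And>n. w n \<in> Q (u n)" "u \<longlonglongrightarrow> u'" "w \<longlonglongrightarrow> w'"
  shows "w' \<in> Q u'"
proof -
  have "(u', w') \<in> sv_graph Q"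
    using assms(1) by (rule closed_sequentially[where f="\<lambda>n. (u n, w n)"])
      (use assms in \<open>auto simp: sv_graph_def intro: tendsto_Pair\<close>)
  then show ?thesis by (simp add: sv_graph_def)
qed

text \<open>Openness at rate \<open>c\<close> survives a single-valued perturbation \<open>g\<close> with constant \<open>m\<close> and a set-valued
  one \<open>Q\<close> with constant \<open>l\<close> when \<open>l + m < c\<close>. Given \<open>z \<in> G u\<close> and \<open>y \<in> Q u\<close> with residual
  \<open>\<parallel>y - g u - z\<parallel> = d\<close>, openness moves \<open>u\<close> by at most \<open>d / c\<close> to a point \<open>u'\<close> where \<open>G\<close> takes the value
  \<open>y - g u\<close>. The new residual consists only of the changes of \<open>y\<close> and \<open>g\<close>, so it is at most \<open>q * d\<close>
  with \<open>q = (l + m) / c < 1\<close>. The steps sum to at most \<open>s\<close>, and the closed graphs make the limit a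
  solution.\<close>

lemma solve_perturbed_inclusion:
  fixes G Q :: "'x::banach \<Rightarrow> 'y::banach set" and g :: "'x \<Rightarrow> 'y"
  assumes G_closed: "closed (sv_graph G)" and Q_closed: "closed (sv_graph Q)"
    and G_open: "linearly_open G x0 z0 c \<epsilon>"
    and Q_lip: "\<And>u u' y. u \<in> ball x0 \<epsilon> \<Longrightarrow> u' \<in> ball x0 \<epsilon> \<Longrightarrow> y \<in> Q u \<Longrightarrow> y \<in> ball y0 \<epsilon> \<Longrightarrow>
                  \<exists>y'\<in>Q u'. norm (y' - y) \<le> l * norm (u' - u)"
    and g_lip: "\<And>u u'. norm (g u' - g u) \<le> m * norm (u' - u)"
    and rates: "l \<ge> 0" "m \<ge> 0" "l + m < c"
    and start: "z0 \<in> G x0" "y0 \<in> Q x0"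
    and s_def: "s = norm (y0 - g x0 - z0) / (c - l - m)"
    and small: "s < \<epsilon>" "c * s < \<epsilon>"
  shows "\<exists>u y. norm (u - x0) \<le> s \<and> y \<in> Q u \<and> y - g u \<in> G u"
proof -
  define q where "q = (l + m) / c"
  define \<delta> where "\<delta> = norm (y0 - g x0 - z0)"
  have c: "c > 0" using rates by linarith
  have q: "0 \<le> q" "q < 1" using rates c by (auto simp: q_def field_simps)
  have s0: "s \<ge> 0" unfolding s_def using rates by simp
  have "c * (1 - q) = c - l - m" using c by (simp add: q_def field_simps)
  then have sd: "\<delta> = c * s * (1 - q)"
    using rates by (simp add: s_def \<delta>_def mult.assoc mult.left_commute[of c])
  \<comment> \<open>The radii \<open>s * (1 - q ^ n)\<close> are the partial sums of the geometric step lengths.\<close>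
  define P where "P n p \<longleftrightarrow> (case p of (u, z, y) \<Rightarrow> z \<in> G u \<and> y \<in> Q u \<and>
      norm (y - g u - z) \<le> \<delta> * q ^ n \<and> norm (u - x0) \<le> s * (1 - q ^ n) \<and>
      norm (y - y0) \<le> l * s * (1 - q ^ n) \<and> norm (z - z0) \<le> c * s * (1 - q ^ n))"
    for n :: nat and p
  define S where "S n p p' \<longleftrightarrow> (case (p, p') of ((u, z, y), (u', z', y')) \<Rightarrow>
      norm (u' - u) \<le> \<delta> / c * q ^ n \<and> norm (y' - y) \<le> l * \<delta> / c * q ^ n)"
    for n :: nat and p p' :: "'x \<times> 'y \<times> 'y"
  have base: "P 0 (x0, z0, y0)" using start by (simp add: P_def \<delta>_def)
  have step: "\<exists>p'. P (Suc n) p' \<and> S n p p'" if Pn: "P n p" for n p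
  proof -
    obtain u z y where p: "p = (u, z, y)" by (cases p)
    have zG: "z \<in> G u" and yQ: "y \<in> Q u" and d: "norm (y - g u - z) \<le> \<delta> * q ^ n"
      and ub: "norm (u - x0) \<le> s * (1 - q ^ n)" and yb: "norm (y - y0) \<le> l * s * (1 - q ^ n)"
      and zb: "norm (z - z0) \<le> c * s * (1 - q ^ n)"
      using Pn by (auto simp: P_def p)
    have qn: "0 \<le> q ^ n" "q ^ n \<le> 1" using q by (auto simp: power_le_one)
    have rad: "r * (1 - q ^ k) \<le> r" if "r \<ge> 0" for r :: real and k
      using that q by (simp add: mult_left_le)
    have cs0: "c * s \<ge> 0" "l * s \<ge> 0" using c s0 rates by auto
    have lscs: "l * s \<le> c * s" using rates s0 by (intro mult_right_mono) auto
    have bounds: "norm (u - x0) \<le> s" "norm (z - z0) \<le> c * s" "norm (y - y0) \<le> l * s"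
      using ub zb yb rad[OF s0, of n] rad[OF cs0(1), of n] rad[OF cs0(2), of n] by linarith+
    define w where "w = y - g u"
    have dw: "dist z w \<le> \<delta> * q ^ n" using d by (simp add: w_def dist_norm norm_minus_commute)
    have t: "dist z w / c \<le> \<delta> / c * q ^ n"
      using divide_right_mono[OF dw, of c] c by simp
    have dc: "\<delta> / c = s * (1 - q)" using c sd by simp
    have "\<delta> / c * q ^ n \<le> s"
      unfolding dc using mult_left_le[OF qn(2), of "s * (1 - q)"] rad[OF s0, of 1] s0 q by simp
    then have t\<epsilon>: "dist z w / c < \<epsilon>" using t small by linarith
    obtain u' where u': "w \<in> G u'" "dist u u' \<le> dist z w / c"
    proof (rule linearly_openD[OF G_open c _ _ zG t\<epsilon>])
      show "dist x0 u < \<epsilon>" "dist z0 z < \<epsilon>"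
        using bounds small by (simp_all add: dist_norm norm_minus_commute)
    qed
    have uu: "norm (u' - u) \<le> \<delta> / c * q ^ n" using u'(2) t by (simp add: dist_norm norm_minus_commute)
    \<comment> \<open>The step length is the increment of the radii, so the distance bounds telescope.\<close>
    have tel: "\<delta> / c * q ^ n = s * (1 - q ^ Suc n) - s * (1 - q ^ n)"
      unfolding dc by (simp add: algebra_simps)
    have u'b: "norm (u' - x0) \<le> s * (1 - q ^ Suc n)"
      using norm_triangle_ineq[of "u' - u" "u - x0"] uu ub tel by simp
    then have u's: "norm (u' - x0) \<le> s" using rad[OF s0, of "Suc n"] by linarith
    have "u \<in> ball x0 \<epsilon>" "u' \<in> ball x0 \<epsilon>" "y \<in> ball y0 \<epsilon>"
      using bounds u's small lscs by (auto simp: dist_norm norm_minus_commute)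
    then obtain y' where y': "y' \<in> Q u'" "norm (y' - y) \<le> l * norm (u' - u)"
      using Q_lip yQ by blast
    have yy: "norm (y' - y) \<le> l * (\<delta> / c * q ^ n)"
      using y'(2) mult_left_mono[OF uu rates(1)] by linarith
    have y'b: "norm (y' - y0) \<le> l * s * (1 - q ^ Suc n)"
      using norm_triangle_ineq[of "y' - y" "y - y0"] yy yb unfolding tel by (simp add: algebra_simps)
    have "norm (w - z) \<le> c * (\<delta> / c * q ^ n)" using dw c by (simp add: dist_norm norm_minus_commute)
    then have w'b: "norm (w - z0) \<le> c * s * (1 - q ^ Suc n)"
      using norm_triangle_ineq[of "w - z" "z - z0"] zb unfolding tel by (simp add: algebra_simps)
    have "norm (y' - g u' - w) \<le> norm (y' - y) + norm (g u' - g u)"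
      using norm_triangle_ineq4[of "y' - y" "g u' - g u"] by (simp add: w_def algebra_simps)
    also have "\<dots> \<le> l * (\<delta> / c * q ^ n) + m * (\<delta> / c * q ^ n)"
      using yy g_lip[of u' u] mult_left_mono[OF uu rates(2)] by linarith
    also have "\<dots> = \<delta> * q ^ Suc n" using c by (simp add: q_def field_simps)
    finally have "P (Suc n) (u', w, y')"
      using u'(1) y'(1) u'b y'b w'b by (simp add: P_def)
    moreover have "S n p (u', w, y')" using uu yy by (simp add: S_def p)
    ultimately show ?thesis by blast
  qed
  obtain p where p: "\<And>n. P n (p n)" "\<And>n. S n (p n) (p (Suc n))"
    using dependent_nat_choice[of P S] base step by blast
  define u where "u n = fst (p n)" for n
  define z where "z n = fst (snd (p n))" for n
  define y where "y n = snd (snd (p n))" for n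
  have Pn: "z n \<in> G (u n)" "y n \<in> Q (u n)" "norm (y n - g (u n) - z n) \<le> \<delta> * q ^ n"
    "norm (u n - x0) \<le> s * (1 - q ^ n)" for n
    using p(1)[of n] by (auto simp: P_def u_def y_def z_def case_prod_beta)
  have Sn: "norm (u (Suc n) - u n) \<le> \<delta> / c * q ^ n"
    "norm (y (Suc n) - y n) \<le> l * \<delta> / c * q ^ n" for n
    using p(2)[of n] by (auto simp: S_def u_def y_def case_prod_beta)
  obtain u' where u': "u \<longlonglongrightarrow> u'"
    using convergent_of_geometric_steps[OF Sn(1) q] by (auto simp: convergent_def)
  obtain y' where y': "y \<longlonglongrightarrow> y'"
    using convergent_of_geometric_steps[OF Sn(2) q] by (auto simp: convergent_def)
  have qlim: "(\<lambda>n. q ^ n) \<longlonglongrightarrow> 0" using q by (intro LIMSEQ_realpow_zero) auto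
  have "(\<lambda>n. norm (u n - u')) \<longlonglongrightarrow> 0" using u' by (simp add: LIM_zero tendsto_norm_zero)
  then have "(\<lambda>n. m * norm (u n - u')) \<longlonglongrightarrow> 0" by (rule tendsto_mult_right_zero)
  then have "(\<lambda>n. g (u n) - g u') \<longlonglongrightarrow> 0"
    by (rule Lim_null_comparison[rotated]) (simp add: g_lip)
  then have glim: "(\<lambda>n. g (u n)) \<longlonglongrightarrow> g u'" by (simp add: LIM_zero_cancel)
  have "(\<lambda>n. y n - g (u n) - z n) \<longlonglongrightarrow> 0"
    by (rule Lim_null_comparison[OF _ tendsto_mult_right_zero[OF qlim, of \<delta>]])
      (simp only: Pn(3) eventually_True)
  then have "(\<lambda>n. (y n - g (u n)) - (y n - g (u n) - z n)) \<longlonglongrightarrow> (y' - g u') - 0"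
    by (intro tendsto_diff y' glim)
  then have zlim: "z \<longlonglongrightarrow> y' - g u'" by simp
  have "(\<lambda>n. norm (u n - x0)) \<longlonglongrightarrow> norm (u' - x0)" by (intro tendsto_intros u')
  moreover have "(\<lambda>n. s * (1 - q ^ n)) \<longlonglongrightarrow> s * (1 - 0)" by (intro tendsto_intros qlim)
  ultimately have "norm (u' - x0) \<le> s * (1 - 0)"
    by (rule LIMSEQ_le) (use Pn(4) in auto)
  then show ?thesis
    using closed_sv_graph_limit[OF Q_closed Pn(2) u' y'] closed_sv_graph_limit[OF G_closed Pn(1) u' zlim]
    by auto
qed

section \<open>Perturbed linearizations\<close>

text \<open>The graph of a linearization is the preimage of the graph of \<open>F\<close> under a continuous shear of
  the product space.\<close>

lemma closed_graph_partial_linearization: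
  assumes "closed (sv_graph F)"
  shows "closed (sv_graph (partial_linearization f F z A))"
proof -
  have "sv_graph (partial_linearization f F z A)
      = (\<lambda>p. (fst p, snd p - f z - blinfun_apply A (fst p - z))) -` sv_graph F"
    (is "?L = ?M")
  proof (intro set_eqI iffI)
    fix p assume "p \<in> ?L"
    then show "p \<in> ?M"
      by (auto simp: sv_graph_def partial_linearization_def elt_set_plus_def)
  next
    fix p assume "p \<in> ?M"
    then have "snd p - f z - blinfun_apply A (fst p - z) \<in> F (fst p)"
      by (simp add: sv_graph_def)
    moreover have "snd p = f z + blinfun_apply A (fst p - z)
                     + (snd p - f z - blinfun_apply A (fst p - z))" by simp
    ultimately show "p \<in> ?L"
      unfolding sv_graph_def partial_linearization_def elt_set_plus_def case_prod_beta by blast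
  qed
  also have "closed \<dots>"
    by (intro closed_vimage assms continuous_intros)
  finally show ?thesis .
qed

lemma closed_graph_section:
  assumes "closed (sv_graph R)"
  shows "closed (sv_graph (\<lambda>u. R (x, u)))"
proof -
  have "sv_graph (\<lambda>u. R (x, u)) = (\<lambda>p. ((x, fst p), snd p)) -` sv_graph R"
    by (auto simp: sv_graph_def)
  also have "closed \<dots>" by (intro closed_vimage assms continuous_intros)
  finally show ?thesis .
qed

text \<open>Moving the base point from \<open>z\<close> to \<open>x\<close> and the operator from \<open>C\<close> to \<open>A\<close> costs the linearization
  error at \<open>x\<close> and the linear term \<open>A - C\<close>. This turns the Newton inclusion at \<open>x\<close> into a perturbation
  of the linearization at \<open>z\<close>.\<close>

lemma shift_linearization:
  assumes "y - (f x - f z - blinfun_apply A (x - z)) - blinfun_apply (A - C) (u - z)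
             \<in> partial_linearization f F z C u"
  shows "y \<in> partial_linearization f F x A u"
proof -
  obtain v where v: "v \<in> F u"
    "y - (f x - f z - blinfun_apply A (x - z)) - blinfun_apply (A - C) (u - z)
      = f z + blinfun_apply C (u - z) + v"
    using assms by (auto simp: partial_linearization_def elt_set_plus_def)
  then have "y = f x + blinfun_apply A (u - x) + v"
    by (simp add: blinfun.diff_left blinfun.diff_right algebra_simps)
  then show ?thesis using v(1) by (auto simp: partial_linearization_def elt_set_plus_def)
qed

text \<open>The perturbations are \<open>g u = e + (A - C) (u - xbar)\<close>, of constant \<open>m\<close>, and the section
  \<open>Rk (x, \<cdot>)\<close>, of constant \<open>l\<close>. The budget \<open>\<gamma>\<close> for the initial residual is shared between the
  linearization error (\<open>\<eta>\<close>) and the element \<open>y0\<close> of \<open>Rk (x, xbar)\<close> (\<open>\<gamma> - \<eta>\<close>). As the Lipschitz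
  condition on \<open>Rk\<close> sees only values in \<open>ball 0 a\<close>, the bound \<open>\<epsilon> \<le> a / 2\<close> is there to put
  \<open>ball y0 \<epsilon>\<close> inside it.\<close>

lemma newton_step:
  fixes F :: "'x::banach \<Rightarrow> 'y::banach set" and Rk :: "'x \<times> 'x \<Rightarrow> 'y set"
  assumes F_closed: "closed (sv_graph F)" and R_closed: "closed (sv_graph Rk)"
    and zero: "0 \<in> partial_linearization f F xbar C xbar"
    and C_open: "linearly_open (partial_linearization f F xbar C) xbar 0 c \<epsilon>"
    and AC: "norm (A - C) \<le> m"
    and rates: "l \<ge> 0" "m \<ge> 0" "l + m + \<gamma> < c" and \<gamma>: "\<gamma> \<ge> 0"
    and approx: "norm (f x - f xbar - blinfun_apply A (x - xbar)) \<le> \<eta> * norm (x - xbar)"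
    and y0: "y0 \<in> Rk (x, xbar)" "norm y0 \<le> (\<gamma> - \<eta>) * norm (x - xbar)"
    and \<eta>: "\<eta> \<ge> 0"
    and R_lip: "\<forall>u\<in>ball xbar a. \<forall>u'\<in>ball xbar a.
         Rk (x, u) \<inter> ball 0 a \<subseteq> Rk (x, u') + (*\<^sub>R) (l * norm (u - u')) ` cball 0 1"
    and \<epsilon>: "\<epsilon> \<le> a / 2"
    and x: "norm (x - xbar) < \<epsilon>" "c * norm (x - xbar) < \<epsilon>"
  shows "\<exists>x'. norm (x' - xbar) \<le> \<gamma> / (c - l - m) * norm (x - xbar) \<and>
              partial_linearization f F x A x' \<inter> Rk (x, x') \<noteq> {}"
proof -
  let ?\<rho> = "norm (x - xbar)"
  define e where "e = f x - f xbar - blinfun_apply A (x - xbar)"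
  define g where "g u = e + blinfun_apply (A - C) (u - xbar)" for u
  define s where "s = norm (y0 - g xbar - 0) / (c - l - m)"
  have "norm (y0 - e) \<le> norm y0 + norm e" by (rule norm_triangle_ineq4)
  also have "\<dots> \<le> \<gamma> * ?\<rho>" using approx y0(2) by (simp add: e_def algebra_simps)
  finally have d: "norm (y0 - g xbar - 0) \<le> \<gamma> * ?\<rho>" by (simp add: g_def)
  have s_t: "s \<le> \<gamma> / (c - l - m) * ?\<rho>"
    using divide_right_mono[OF d, of "c - l - m"] rates \<gamma> by (simp add: s_def)
  have s_\<rho>: "s \<le> ?\<rho>"
  proof -
    have "\<gamma> / (c - l - m) \<le> 1" using rates \<gamma> by (subst divide_le_eq_1_pos) linarith+
    from mult_right_mono[OF this, of ?\<rho>] show ?thesis using s_t by simp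
  qed
  have c: "c > 0" "\<gamma> \<le> c" using rates \<gamma> by linarith+
  have small: "s < \<epsilon>" "c * s < \<epsilon>"
    using s_\<rho> x mult_left_mono[OF s_\<rho>, of c] c(1) by linarith+
  have "\<exists>u y. norm (u - xbar) \<le> s \<and> y \<in> Rk (x, u) \<and> y - g u \<in> partial_linearization f F xbar C u"
  proof (rule solve_perturbed_inclusion[where Q = "\<lambda>u. Rk (x, u)" and g = g,
          OF closed_graph_partial_linearization[OF F_closed]
          closed_graph_section[OF R_closed] C_open _ _ rates(1,2) _ zero y0(1) s_def])
    fix u u' y
    assume uu: "u \<in> ball xbar \<epsilon>" "u' \<in> ball xbar \<epsilon>" and y: "y \<in> Rk (x, u)" "y \<in> ball y0 \<epsilon>"
    have a: "\<epsilon> \<le> a" using \<epsilon> x norm_ge_zero[of "x - xbar"] by linarith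
    have "(\<gamma> - \<eta>) * ?\<rho> \<le> c * ?\<rho>"
      using \<eta> rates by (intro mult_right_mono) auto
    then have "norm y0 < \<epsilon>" using y0(2) x by linarith
    then have "y \<in> ball 0 a"
      using y(2) \<epsilon> norm_triangle_ineq[of "y - y0" y0] by (simp add: dist_norm norm_minus_commute)
    then have "y \<in> Rk (x, u') + (*\<^sub>R) (l * norm (u - u')) ` cball 0 1"
      using R_lip uu a y(1) by fastforce
    then obtain y' b where y': "y' \<in> Rk (x, u')" "norm b \<le> 1" "y = y' + (l * norm (u - u')) *\<^sub>R b"
      by (auto simp: set_plus_def)
    have "norm (y' - y) = l * norm (u' - u) * norm b"
      using rates(1) by (simp add: y'(3) abs_mult norm_minus_commute)
    also have "\<dots> \<le> l * norm (u' - u)" using y'(2) rates(1) by (simp add: mult_left_le)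
    finally show "\<exists>y'\<in>Rk (x, u'). norm (y' - y) \<le> l * norm (u' - u)" using y'(1) by blast
  next
    fix u u'
    have "norm (g u' - g u) = norm (blinfun_apply (A - C) (u' - u))"
      by (simp add: g_def blinfun.diff_right)
    also have "\<dots> \<le> norm (A - C) * norm (u' - u)" by (rule norm_blinfun)
    also have "\<dots> \<le> m * norm (u' - u)" using AC by (simp add: mult_right_mono)
    finally show "norm (g u' - g u) \<le> m * norm (u' - u)" .
  qed (use rates \<gamma> small in auto)
  then obtain u y where u: "norm (u - xbar) \<le> s" "y \<in> Rk (x, u)"
    "y - g u \<in> partial_linearization f F xbar C u"
    by (elim exE conjE)
  have "y \<in> partial_linearization f F x A u"
    by (rule shift_linearization[where z = xbar and C = C])
      (use u(3) in \<open>simp add: g_def e_def diff_diff_eq\<close>)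
  then show ?thesis using u(1,2) s_t by (intro exI[of _ u]) auto
qed

section \<open>Uniformity near the solution\<close>

text \<open>The noncompactness measure yields a net with closed balls of some radius \<open>r < m\<close>. Enlarging
  the radius to \<open>m\<close> makes room for open balls, whose union upper semicontinuity can be applied to.\<close>

lemma finite_net_near:
  assumes usc: "upper_semicontinuous_at H xbar"
    and chi: "noncompactness_measure (H xbar) < ennreal m"
  obtains E d where "finite E" "E \<subseteq> H xbar" "d > 0"
    "\<And>x A. x \<in> ball xbar d \<Longrightarrow> A \<in> H x \<Longrightarrow> \<exists>C\<in>E. norm (A - C) \<le> m"
proof -
  obtain r E where r: "ennreal r < ennreal m" "r > 0" and E: "finite E" "E \<subseteq> H xbar"
    "H xbar \<subseteq> E + (*\<^sub>R) r ` cball 0 1"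
    using chi unfolding noncompactness_measure_def Inf_less_iff by blast
  have rm: "r < m" using r by (simp add: ennreal_less_iff)
  let ?W = "\<Union>C\<in>E. ball C m"
  have "H xbar \<subseteq> ?W"
  proof
    fix A assume "A \<in> H xbar"
    then obtain C b where C: "C \<in> E" "norm b \<le> 1" "A = C + r *\<^sub>R b"
      using E(3) by (auto simp: set_plus_def)
    have "norm (r *\<^sub>R b) \<le> r" using C(2) r(2) by (simp add: mult_left_le)
    then have "A \<in> ball C m" using C(3) rm by (simp add: dist_norm)
    then show "A \<in> ?W" using C(1) by blast
  qed
  moreover have "open ?W" by auto
  ultimately obtain U where U: "open U" "xbar \<in> U" "\<forall>u\<in>U. H u \<subseteq> ?W"
    using usc unfolding upper_semicontinuous_at_def by blast
  obtain d where d: "d > 0" "ball xbar d \<subseteq> U" using U(1,2) open_contains_ball by blast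
  show ?thesis
  proof (rule that[OF E(1,2) d(1)])
    fix x A assume "x \<in> ball xbar d" "A \<in> H x"
    then have "A \<in> ?W" using d(2) U(3) by blast
    then show "\<exists>C\<in>E. norm (A - C) \<le> m" by (auto simp: dist_norm norm_minus_commute intro: less_imp_le)
  qed
qed

lemma linearly_open_uniform:
  assumes "finite E" "\<And>C. C \<in> E \<Longrightarrow> \<exists>\<epsilon>>0. linearly_open (G C) x0 z0 c \<epsilon>"
  shows "\<exists>\<epsilon>>0. \<forall>C\<in>E. linearly_open (G C) x0 z0 c \<epsilon>"
  using assms
proof (induction E rule: finite_induct)
  case empty
  show ?case by (auto intro: exI[of _ 1])
next
  case (insert C E)
  obtain \<epsilon>1 where e1: "\<epsilon>1 > 0" "\<forall>C\<in>E. linearly_open (G C) x0 z0 c \<epsilon>1" using insert by auto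
  obtain \<epsilon>2 where e2: "\<epsilon>2 > 0" "linearly_open (G C) x0 z0 c \<epsilon>2" using insert by auto
  have "\<forall>C'\<in>insert C E. linearly_open (G C') x0 z0 c (min \<epsilon>1 \<epsilon>2)"
    using e1(2) linearly_open_mono[OF e2(2) min.cobounded2]
    by (auto intro: linearly_open_mono[OF _ min.cobounded1])
  then show ?case using e1 e2 by (intro exI[of _ "min \<epsilon>1 \<epsilon>2"]) auto
qed

lemma eventually_quotient_less:
  fixes h :: "'a::real_normed_vector \<Rightarrow> ennreal"
  assumes "\<forall>\<^sub>F x in at z. h x / ennreal (norm (x - z)) < ennreal b" "b \<ge> 0"
  obtains d where "d > 0" "\<And>x. x \<noteq> z \<Longrightarrow> x \<in> ball z d \<Longrightarrow> h x < ennreal (b * norm (x - z))"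
proof -
  obtain d where d: "d > 0" "\<And>x. x \<noteq> z \<Longrightarrow> dist x z < d \<Longrightarrow> h x / ennreal (norm (x - z)) < ennreal b"
    using assms(1) unfolding eventually_at by auto
  show ?thesis
  proof (rule that[OF d(1)])
    fix x assume x: "x \<noteq> z" "x \<in> ball z d"
    then have "h x / ennreal (norm (x - z)) < ennreal b" using d(2) by (simp add: dist_commute)
    then show "h x < ennreal (b * norm (x - z))"
      using x(1) assms(2) by (simp add: ennreal_mult divide_less_ennreal)
  qed
qed

section \<open>Local convergence for every choice rule\<close>

text \<open>A choice rule \<open>\<sigma>\<close> sees the whole history, so the recursion is on histories and the iterates are
  read off as their last entries. Invariance of the ball (\<open>t \<le> 1\<close>) keeps each iterate where \<open>H\<close> is
  nonempty and \<open>step\<close> applies.\<close>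

lemma iterates_of_steps:
  fixes H :: "'x::real_normed_vector \<Rightarrow> ('x \<Rightarrow>\<^sub>L 'y::real_normed_vector) set"
  assumes step: "\<And>x A k. x \<in> ball z r \<Longrightarrow> A \<in> H x \<Longrightarrow>
      \<exists>x'. norm (x' - z) \<le> t * norm (x - z) \<and>
           partial_linearization f F x A x' \<inter> R k (x, x') \<noteq> {}"
    and dom: "\<And>x. x \<in> ball z r \<Longrightarrow> H x \<noteq> {}"
    and t: "t \<le> 1" and x0: "x0 \<in> ball z r" and \<sigma>: "choice_rule H \<sigma>"
  shows "\<exists>x. x 0 = x0 \<and> (\<forall>k. x k \<in> ball z r) \<and> newton_iterates f F H R \<sigma> x \<and>
           (\<forall>k. norm (x (Suc k) - z) \<le> t * norm (x k - z))"
proof -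
  define good where "good k h x' \<longleftrightarrow> norm (x' - z) \<le> t * norm (last h - z) \<and>
      partial_linearization f F (last h) (\<sigma> h) x' \<inter> R k (last h, x') \<noteq> {}" for k h x'
  define hist where "hist = rec_nat [x0] (\<lambda>k h. h @ [SOME x'. good k h x'])"
  define x where "x k = last (hist k)" for k
  have hist_Suc: "hist (Suc k) = hist k @ [SOME x'. good k (hist k) x']" for k
    by (simp add: hist_def)
  have hist_map: "hist k = map x [0..<Suc k]" for k
  proof (induction k)
    case 0
    then show ?case by (simp add: x_def hist_def)
  next
    case (Suc k)
    have "hist (Suc k) = hist k @ [x (Suc k)]" by (simp add: hist_Suc x_def)
    then show ?case using Suc by simp
  qed
  have next_good: "\<sigma> (hist k) \<in> H (x k) \<and> good k (hist k) (x (Suc k))" if xk: "x k \<in> ball z r" for k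
  proof -
    have "hist k \<noteq> []" using hist_map[of k] by simp
    then have A: "\<sigma> (hist k) \<in> H (x k)"
      using \<sigma> dom[OF xk] unfolding choice_rule_def x_def by blast
    have "\<exists>x'. good k (hist k) x'"
      using step[OF xk A, of k] unfolding good_def x_def .
    from someI_ex[OF this] A show ?thesis by (simp add: x_def hist_Suc)
  qed
  have in_ball: "x k \<in> ball z r" for k
  proof (induction k)
    case 0
    then show ?case using x0 by (simp add: x_def hist_def)
  next
    case (Suc k)
    have "norm (x (Suc k) - z) \<le> t * norm (x k - z)"
      using next_good[OF Suc] by (simp add: good_def x_def)
    also have "\<dots> \<le> norm (x k - z)" using mult_right_mono[OF t, of "norm (x k - z)"] by simp
    finally show ?case using Suc by (simp add: dist_norm norm_minus_commute)
  qed
  have "x 0 = x0" by (simp add: x_def hist_def)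
  moreover have "newton_iterates f F H R \<sigma> x"
    unfolding newton_iterates_def hist_map[symmetric]
    using next_good[OF in_ball] by (auto simp: good_def x_def[symmetric])
  moreover have "norm (x (Suc k) - z) \<le> t * norm (x k - z)" for k
    using next_good[OF in_ball, of k] by (simp add: good_def x_def[symmetric])
  ultimately show ?thesis using in_ball by blast
qed

theorem theorem5p1:
  fixes f :: "'x::banach \<Rightarrow> 'y::banach"
    and F :: "'x \<Rightarrow> 'y set"
    and H :: "'x \<Rightarrow> ('x \<Rightarrow>\<^sub>L 'y) set"
    and R :: "nat \<Rightarrow> 'x \<times> 'x \<Rightarrow> 'y set"
    and xbar :: 'x
    and a \<gamma> l :: real
  assumes f_cont: "continuous_on UNIV f"
    and F_closed: "closed (sv_graph F)"
    and sol: "0 \<in> f xbar +o F xbar"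
    and H_usc: "upper_semicontinuous_at H xbar"
    and H_dom: "xbar \<in> interior (sv_dom H)"
    and H_chi: "noncompactness_measure (H xbar) < \<infinity>"
    and G_reg: "\<forall>A\<in>H xbar. metrically_regular_around (partial_linearization f F xbar A) xbar 0"
    and H_approx:
      "((\<lambda>x. (SUP A\<in>H x. ennreal (norm (f x - f xbar - blinfun_apply A (x - xbar))))
              / ennreal (norm (x - xbar))) \<longlongrightarrow> 0) (at xbar)"
    and R_closed: "\<forall>k. closed (sv_graph (R k))"
    and R_dom: "(xbar, xbar) \<in> interior (\<Inter>k. sv_dom (R k))"
    and R_zero: "\<forall>k. 0 \<in> R k (xbar, xbar)"
    and consts_pos: "a > 0" "\<gamma> > 0" "l > 0"
    and consts_less:
      "noncompactness_measure (H xbar) + ennreal l + ennreal \<gamma>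
         < (INF A\<in>H xbar. surjection_modulus (partial_linearization f F xbar A) xbar 0)"
    and R_limsup:
      "Limsup (at xbar) (\<lambda>x. (SUP k. set_dist 0 (R k (x, xbar))) / ennreal (norm (x - xbar)))
         < ennreal \<gamma>"
    and R_lip:
      "\<forall>x\<in>ball xbar a. \<forall>u\<in>ball xbar a. \<forall>u'\<in>ball xbar a. \<forall>k.
         R k (x, u) \<inter> ball 0 a \<subseteq> R k (x, u') + (*\<^sub>R) (l * norm (u - u')) ` cball 0 1"
  shows "\<exists>t r. 0 < t \<and> t < 1 \<and> r > 0 \<and>
    (\<forall>x0\<in>ball xbar r. \<forall>\<sigma>. choice_rule H \<sigma> \<longrightarrow>
      (\<exists>x. x 0 = x0 \<and> (\<forall>k. x k \<in> ball xbar r) \<and> newton_iterates f F H R \<sigma> x \<and>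
           (\<forall>k. norm (x (Suc k) - xbar) \<le> t * norm (x k - xbar))))"
proof -
  let ?G = "partial_linearization f F xbar"
  have H_ne: "H xbar \<noteq> {}" using H_dom interior_subset by (auto simp: sv_dom_def)
  obtain c' where c': "noncompactness_measure (H xbar) + ennreal l + ennreal \<gamma> < c'"
    "c' < (INF A\<in>H xbar. surjection_modulus (?G A) xbar 0)"
    using dense[OF consts_less] by blast
  obtain c where c: "c' = ennreal c" "c \<ge> 0"
    using c'(2) by (cases c') auto
  obtain \<mu> where \<mu>: "noncompactness_measure (H xbar) = ennreal \<mu>" "\<mu> \<ge> 0"
    using H_chi by (cases "noncompactness_measure (H xbar)") auto
  have "\<mu> + l + \<gamma> < c"
    using c'(1) \<mu> consts_pos unfolding c(1) by (simp flip: ennreal_plus add: ennreal_less_iff)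
  then obtain m where m: "\<mu> < m" "m < c - l - \<gamma>" using dense[of \<mu> "c - l - \<gamma>"] by auto
  have chi_m: "noncompactness_measure (H xbar) < ennreal m"
    using \<mu> m by (simp add: ennreal_less_iff)
  obtain E d1 where E: "finite E" "E \<subseteq> H xbar" "d1 > 0"
    "\<And>x A. x \<in> ball xbar d1 \<Longrightarrow> A \<in> H x \<Longrightarrow> \<exists>C\<in>E. norm (A - C) \<le> m"
    using finite_net_near[OF H_usc chi_m] by blast
  have "\<exists>\<epsilon>>0. linearly_open (?G C) xbar 0 c \<epsilon>" if "C \<in> E" for C
    using that E(2) c c'(2)
    by (intro linearly_open_below_surjection_modulus) (auto intro: less_le_trans INF_lower)
  then obtain \<epsilon>0 where \<epsilon>0: "\<epsilon>0 > 0" "\<And>C. C \<in> E \<Longrightarrow> linearly_open (?G C) xbar 0 c \<epsilon>0"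
    using linearly_open_uniform[OF E(1)] by metis
  \<comment> \<open>The number \<open>g\<close> leaves the gap \<open>\<gamma> - g\<close> as a bound for the linearization error.\<close>
  obtain g where g: "Limsup (at xbar) (\<lambda>x. (SUP k. set_dist 0 (R k (x, xbar))) / ennreal (norm (x - xbar)))
         < ennreal g" "g < \<gamma>" "g \<ge> 0"
  proof -
    obtain g' where g': "Limsup (at xbar) (\<lambda>x. (SUP k. set_dist 0 (R k (x, xbar))) / ennreal (norm (x - xbar)))
         < g'" "g' < ennreal \<gamma>"
      using dense[OF R_limsup] by blast
    then show ?thesis using that by (cases g') (auto simp: ennreal_less_iff)
  qed
  obtain d2 where d2: "d2 > 0" "\<And>x. x \<noteq> xbar \<Longrightarrow> x \<in> ball xbar d2 \<Longrightarrow>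
      (SUP k. set_dist 0 (R k (x, xbar))) < ennreal (g * norm (x - xbar))"
    using eventually_quotient_less[OF Limsup_lessD[OF g(1)] g(3)] by blast
  obtain d3 where d3: "d3 > 0" "\<And>x. x \<noteq> xbar \<Longrightarrow> x \<in> ball xbar d3 \<Longrightarrow>
      (SUP A\<in>H x. ennreal (norm (f x - f xbar - blinfun_apply A (x - xbar))))
        < ennreal ((\<gamma> - g) * norm (x - xbar))"
    using eventually_quotient_less[OF order_tendstoD(2)[OF H_approx, of "ennreal (\<gamma> - g)"]] g(2)
    by auto
  obtain d4 where d4: "d4 > 0" "ball xbar d4 \<subseteq> sv_dom H"
    using H_dom mem_interior by blast
  define \<epsilon> where "\<epsilon> = min \<epsilon>0 (a / 2)"
  have \<epsilon>: "\<epsilon> > 0" "\<epsilon> \<le> a / 2" "\<epsilon> \<le> \<epsilon>0" using \<epsilon>0 consts_pos by (auto simp: \<epsilon>_def)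
  have cpos: "c > 0" using m \<mu> consts_pos by linarith
  \<comment> \<open>The bound \<open>\<epsilon> / c\<close> keeps the values of the linearization met during a step within \<open>\<epsilon>\<close> of \<open>0\<close>.\<close>
  define r where "r = Min {d1, d2, d3, d4, \<epsilon>, \<epsilon> / c}"
  have r: "r > 0" "r \<le> d1" "r \<le> d2" "r \<le> d3" "r \<le> d4" "r \<le> \<epsilon>" "r \<le> \<epsilon> / c"
    using E(3) d2(1) d3(1) d4(1) \<epsilon>(1) cpos by (auto simp: r_def)
  define t where "t = \<gamma> / (c - l - m)"
  have t: "0 < t" "t < 1" using m consts_pos by (auto simp: t_def)
  have zero: "0 \<in> ?G C xbar" for C using sol by (simp add: partial_linearization_def)
  have step: "\<exists>x'. norm (x' - xbar) \<le> t * norm (x - xbar) \<and>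
           partial_linearization f F x A x' \<inter> R k (x, x') \<noteq> {}"
    if x: "x \<in> ball xbar r" and A: "A \<in> H x" for x A k
  proof (cases "x = xbar")
    case True
    \<comment> \<open>The quotient conditions say nothing at \<open>xbar\<close> itself, but there the iteration may stay put.\<close>
    then show ?thesis using zero[of A] R_zero by (intro exI[of _ xbar]) auto
  next
    case False
    obtain C where C: "C \<in> E" "norm (A - C) \<le> m" using E(4)[of x A] x A r by auto
    have "set_dist 0 (R k (x, xbar)) < ennreal (g * norm (x - xbar))"
      using SUP_lessD[OF d2(2)[OF False] UNIV_I] x r by simp
    then obtain y0 where y0: "y0 \<in> R k (x, xbar)" "ennreal (norm y0) < ennreal (g * norm (x - xbar))"
      unfolding set_dist_def INF_less_iff by auto
    then have y0n: "norm y0 \<le> (\<gamma> - (\<gamma> - g)) * norm (x - xbar)"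
      by (simp add: ennreal_less_iff)
    have "ennreal (norm (f x - f xbar - blinfun_apply A (x - xbar))) < ennreal ((\<gamma> - g) * norm (x - xbar))"
      using SUP_lessD[OF d3(2)[OF False] A] x r by simp
    then have approx: "norm (f x - f xbar - blinfun_apply A (x - xbar)) \<le> (\<gamma> - g) * norm (x - xbar)"
      by (simp add: ennreal_less_iff)
    have xr: "norm (x - xbar) < r" using x by (simp add: dist_norm norm_minus_commute)
    have "x \<in> ball xbar a" using xr r(6) \<epsilon>(1,2) by (simp add: dist_norm norm_minus_commute)
    then have lip: "\<forall>u\<in>ball xbar a. \<forall>u'\<in>ball xbar a.
         R k (x, u) \<inter> ball 0 a \<subseteq> R k (x, u') + (*\<^sub>R) (l * norm (u - u')) ` cball 0 1"
      using bspec[OF R_lip] by simp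
    have "norm (x - xbar) < \<epsilon> / c" using xr r(7) by linarith
    then have xs: "norm (x - xbar) < \<epsilon>" "c * norm (x - xbar) < \<epsilon>"
      using xr r(6) cpos by (auto simp: field_simps)
    show ?thesis unfolding t_def
    proof (rule newton_step[where Rk = "R k" and f = f and C = C and c = c and a = a and \<epsilon> = \<epsilon>
            and m = m and l = l and \<gamma> = \<gamma> and \<eta> = "\<gamma> - g" and ?y0.0 = y0])
      show "linearly_open (?G C) xbar 0 c \<epsilon>" by (rule linearly_open_mono[OF \<epsilon>0(2)[OF C(1)] \<epsilon>(3)])
      show "0 \<in> ?G C xbar" by (rule zero)
      show "closed (sv_graph (R k))" using R_closed by blast
    qed (fact F_closed C(2) approx y0(1) y0n lip \<epsilon>(2) xs | use consts_pos m \<mu> g in linarith)+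
  qed
  have dom: "H x \<noteq> {}" if "x \<in> ball xbar r" for x
    using that d4(2) r(5) by (auto simp: sv_dom_def subset_iff)
  show ?thesis
  proof (rule exI[of _ t], rule exI[of _ r], intro conjI ballI allI impI t r(1))
    fix x0 \<sigma>
    assume start: "x0 \<in> ball xbar r" and \<sigma>: "choice_rule H \<sigma>"
    show "\<exists>x. x 0 = x0 \<and> (\<forall>k. x k \<in> ball xbar r) \<and> newton_iterates f F H R \<sigma> x \<and>
           (\<forall>k. norm (x (Suc k) - xbar) \<le> t * norm (x k - xbar))"
      using less_imp_le[OF t(2)] start \<sigma>
      by (rule iterates_of_steps[rotated 2, OF _ _ _ step dom])
  qed
qed

end
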